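(* Let $V$ be a valuation domain of rank $1$ which is not discrete, with quotient field $K$. The following are equivalent: (i) the residue field of $V$ is finite; (ii) the Zariski and the constructible topologies coincide on $\mathcal{V}$; (iii) there is a $\delta\in\mathbb{R}\cup\{+\infty\}$ such that the Zariski and the constructible topologies coincide on $\bigcup_{\delta'\leq\delta}\mathcal{V}(\bullet,\delta')$; (iv) there is a $\delta\in\mathbb{R}\cup\{+\infty\}$ such that the Zariski and the constructible topologies coincide on $\bigcup_{\delta'<\delta}\mathcal{V}(\bullet,\delta')$.
   Context: Let $v$ be the valuation of $V$, with value group regarded as a subgroup of $\mathbb{R}$. A sequence $E=\{s_n\}_{n\in\mathbb{N}}$ in $K$ is pseudo-convergent if $v(s_{n+1}-s_n)<v(s_{n+2}-s_{n+1})$ for all $n$. Its breadth is $\delta_E=\lim_{n\to\infty}v(s_{n+1}-s_n)\in\mathbb{R}\cup\{\infty\}$. Let $V_E=\{\phi\in K(X)\mid \phi(s_n)\in V\text{ for all but finitely many }n\in\mathbb{N}\}$, a valuation domain of $K(X)$ lying over $V$. Set $\mathcal{V}=\{V_E\mid E\subset K\text{ is a pseudo-convergent sequence}\}$, and let $\mathcal{V}(\bullet,\delta)$ be the set of those $V_E$ such that $E$ has breadth $\delta$. $\mathrm{Zar}(K(X)|V)$ is the set of valuation domains of $K(X)$ containing $V$. The Zariski topology on it is generated by the subbasic open sets $B(\phi)=\{Z\in\mathrm{Zar}(K(X)|V)\mid \phi\in Z\}$, $\phi\in K(X)$; the constructible topology is the coarsest topology in which all the sets $B(\phi_1)\cap\cdots\cap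 B(\phi_k)$ are both open and closed. Subsets of $\mathrm{Zar}(K(X)|V)$ carry the respective subspace topologies. *)

theory Defs
  imports
    "HOL-Analysis.Analysis"
    "HOL-Computational_Algebra.Polynomial"
    "HOL-Computational_Algebra.Fraction_Field"
begin

text \<open>
  The field \<open>K\<close> is a type of class \<open>field\<close>, and \<open>K(X)\<close> is the type \<open>'a poly fract\<close>.
  Subrings, in particular valuation domains, are subsets of the ambient field.
\<close>

definition subring_of_field :: "'f::field set \<Rightarrow> bool" where
  "subring_of_field A \<longleftrightarrow>
     1 \<in> A \<and> (\<forall>x\<in>A. \<forall>y\<in>A. x - y \<in> A) \<and> (\<forall>x\<in>A. \<forall>y\<in>A. x * y \<in> A)"

text \<open>The condition forces the quotient field of \<open>A\<close> to be the whole type.\<close>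

definition valuation_domain :: "'f::field set \<Rightarrow> bool" where
  "valuation_domain A \<longleftrightarrow> subring_of_field A \<and> (\<forall>x. x \<noteq> 0 \<longrightarrow> x \<in> A \<or> inverse x \<in> A)"

definition ideal_in :: "'f::field set \<Rightarrow> 'f set \<Rightarrow> bool" where
  "ideal_in A I \<longleftrightarrow>
     I \<subseteq> A \<and> 0 \<in> I \<and> (\<forall>x\<in>I. \<forall>y\<in>I. x + y \<in> I) \<and> (\<forall>a\<in>A. \<forall>x\<in>I. a * x \<in> I)"

definition prime_ideal_in :: "'f::field set \<Rightarrow> 'f set \<Rightarrow> bool" where
  "prime_ideal_in A P \<longleftrightarrow>
     ideal_in A P \<and> P \<noteq> A \<and> (\<forall>x\<in>A. \<forall>y\<in>A. x * y \<in> P \<longrightarrow> x \<in> P \<or> y \<in> P)"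

text \<open>The rank of a valuation domain is its Krull dimension.\<close>

definition krull_dim :: "'f::field set \<Rightarrow> enat" where
  "krull_dim A =
     (SUP n \<in> {n. \<exists>P. (\<forall>i\<le>n. prime_ideal_in A (P i)) \<and> (\<forall>i<n. P i \<subset> P (Suc i))}. enat n)"

text \<open>The maximal ideal consists of the non-units.\<close>

definition max_ideal :: "'f::field set \<Rightarrow> 'f set" where
  "max_ideal A = {x \<in> A. x = 0 \<or> inverse x \<notin> A}"

definition residue_field :: "'f::field set \<Rightarrow> 'f set set" where
  "residue_field A = A // {(x, y). x \<in> A \<and> y \<in> A \<and> x - y \<in> max_ideal A}"

text \<open>\<open>v\<close> is a valuation, with value group inside \<open>\<real>\<close>, whose valuation domain is \<open>A\<close>.\<close>

definition real_valuation_of :: "('f::field \<Rightarrow> ereal) \<Rightarrow> 'f set \<Rightarrow> bool" where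
  "real_valuation_of v A \<longleftrightarrow>
     (\<forall>x. v x \<noteq> -\<infinity>) \<and> (\<forall>x. v x = \<infinity> \<longleftrightarrow> x = 0) \<and>
     (\<forall>x y. v (x * y) = v x + v y) \<and>
     (\<forall>x y. min (v x) (v y) \<le> v (x + y)) \<and>
     A = {x. 0 \<le> v x}"

definition value_group :: "('f::field \<Rightarrow> ereal) \<Rightarrow> real set" where
  "value_group v = {r. \<exists>x. x \<noteq> 0 \<and> v x = ereal r}"

definition discrete_valuation :: "('f::field \<Rightarrow> ereal) \<Rightarrow> bool" where
  "discrete_valuation v \<longleftrightarrow> (\<exists>g>0. value_group v = range (\<lambda>n::int. of_int n * g))"

definition pseudo_convergent :: "('f::field \<Rightarrow> ereal) \<Rightarrow> (nat \<Rightarrow> 'f) \<Rightarrow> bool" where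
  "pseudo_convergent v s \<longleftrightarrow>
     (\<forall>n. v (s (n + 1) - s n) < v (s (n + 2) - s (n + 1)))"

definition breadth :: "('f::field \<Rightarrow> ereal) \<Rightarrow> (nat \<Rightarrow> 'f) \<Rightarrow> ereal" where
  "breadth v s = lim (\<lambda>n. v (s (n + 1) - s n))"

text \<open>
  \<open>ratfun_value \<phi> a y\<close> says that the rational function \<open>\<phi>\<close> is defined at \<open>a\<close>, with value \<open>y\<close>.
\<close>

definition ratfun_value :: "'a::field poly fract \<Rightarrow> 'a \<Rightarrow> 'a \<Rightarrow> bool" where
  "ratfun_value \<phi> a y \<longleftrightarrow>
     (\<exists>p q. \<phi> = Fract p q \<and> poly q a \<noteq> 0 \<and> y = poly p a / poly q a)"

definition V_seq :: "'a::field set \<Rightarrow> (nat \<Rightarrow> 'a) \<Rightarrow> 'a poly fract set" where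
  "V_seq V s = {\<phi>. \<forall>\<^sub>\<infinity>n. \<exists>y\<in>V. ratfun_value \<phi> (s n) y}"

definition V_all :: "('a::field \<Rightarrow> ereal) \<Rightarrow> 'a set \<Rightarrow> 'a poly fract set set" where
  "V_all v V = {V_seq V s | s. pseudo_convergent v s}"

definition V_breadth :: "('a::field \<Rightarrow> ereal) \<Rightarrow> 'a set \<Rightarrow> ereal \<Rightarrow> 'a poly fract set set" where
  "V_breadth v V \<delta> = {V_seq V s | s. pseudo_convergent v s \<and> breadth v s = \<delta>}"

definition Zar :: "'a::field set \<Rightarrow> 'a poly fract set set" where
  "Zar V = {Z. valuation_domain Z \<and> (\<lambda>a. Fract [:a:] 1) ` V \<subseteq> Z}"

definition Zar_B :: "'a::field set \<Rightarrow> 'a poly fract \<Rightarrow> 'a poly fract set set" where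
  "Zar_B V \<phi> = {Z \<in> Zar V. \<phi> \<in> Z}"

definition zariski_topology :: "'a::field set \<Rightarrow> 'a poly fract set topology" where
  "zariski_topology V = topology_generated_by (range (Zar_B V))"

definition constructible_topology :: "'a::field set \<Rightarrow> 'a poly fract set topology" where
  "constructible_topology V = topology_generated_by
     (\<Union>F\<in>{F. finite F \<and> F \<noteq> {}}. {\<Inter> (Zar_B V ` F), Zar V - \<Inter> (Zar_B V ` F)})"

definition zar_eq_cons_on :: "'a::field set \<Rightarrow> 'a poly fract set set \<Rightarrow> bool" where
  "zar_eq_cons_on V S \<longleftrightarrow>
     subtopology (zariski_topology V) S = subtopology (constructible_topology V) S"

end

(*
  If the residue field is finite, some N > 0 satisfies y^N - 1 in M for all units y of V, where M is
  the maximal ideal.  Then psi lies outside V_E exactly if both 1/psi and 1/(psi^(-N) - 1) lie in V_E,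
  so the complement of a subbasic open set is again Zariski open on the set of all V_E.

  If the residue field is infinite, choose c, d with v(c) < v(d) < delta and x_n with v(x_n)
  increasing to 0, and let W(a,d) be V_E for E = (a + d x_n), of breadth v(d).  The elements of W(0,c)
  lie in the Gauss extension attached to X/c, so their reductions are rational functions in X/c over
  the residue field.  Given finitely many of them, pick u in V whose residue is not a pole: they all
  lie in W(cu,d).  As X/c lies in each W(cu,d) but not in W(0,c), the set of points not containing X/c
  is constructibly but not Zariski open.
*)

theory Submission
  imports Defs
begin

section \<open>Subrings and values of rational functions\<close>

lemma subring_of_field_zero: "subring_of_field A \<Longrightarrow> 0 \<in> A"
  unfolding subring_of_field_def by (metis diff_self)

lemma subring_of_field_diff: "subring_of_field A \<Longrightarrow> x \<in> A \<Longrightarrow> y \<in> A \<Longrightarrow> x - y \<in> A"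
  unfolding subring_of_field_def by blast

lemma subring_of_field_mult: "subring_of_field A \<Longrightarrow> x \<in> A \<Longrightarrow> y \<in> A \<Longrightarrow> x * y \<in> A"
  unfolding subring_of_field_def by blast

lemma subring_of_field_add: "subring_of_field A \<Longrightarrow> x \<in> A \<Longrightarrow> y \<in> A \<Longrightarrow> x + y \<in> A"
  using subring_of_field_diff[of A x "0 - y"] subring_of_field_diff[of A 0 y]
    subring_of_field_zero[of A] by simp

lemma subring_of_field_power: "subring_of_field A \<Longrightarrow> x \<in> A \<Longrightarrow> x ^ n \<in> A"
  by (induction n) (simp_all add: subring_of_field_mult, simp add: subring_of_field_def)

lemma subring_of_field_sum:
  "subring_of_field A \<Longrightarrow> (\<And>i. i \<in> I \<Longrightarrow> f i \<in> A) \<Longrightarrow> sum f I \<in> A"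
  by (induction I rule: infinite_finite_induct)
    (auto simp: subring_of_field_zero subring_of_field_add)

text \<open>Locality of \<open>Z\<close>: one of \<open>x / y\<close> and \<open>y / x\<close> lies
  in \<open>Z\<close>, and adding 1 to it gives \<open>inverse y\<close> or
  \<open>inverse x\<close>.\<close>

lemma valuation_domain_local:
  assumes Z: "valuation_domain Z" and xy: "x \<in> Z" "y \<in> Z" "x + y = 1" "x \<noteq> 0" "y \<noteq> 0"
  shows "inverse x \<in> Z \<or> inverse y \<in> Z"
proof -
  have sub: "subring_of_field Z" and one: "1 \<in> Z"
    using Z by (auto simp: valuation_domain_def subring_of_field_def)
  have "x / y \<in> Z \<or> inverse (x / y) \<in> Z"
    using Z xy by (simp add: valuation_domain_def del: inverse_divide)
  moreover have "inverse y = 1 + x / y" "inverse x = 1 + inverse (x / y)"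
    using xy by (auto simp: field_simps)
  ultimately show ?thesis
    using subring_of_field_add[OF sub one] by metis
qed

text \<open>If \<open>\<psi>\<close> is not in \<open>Z\<close>, its inverse is a non-unit, so
  \<open>1 - inverse \<psi> ^ N\<close> is a unit by locality. As \<open>inverse 0 = 0\<close>, the
  claim \<open>\<eta> \<noteq> 0\<close> records that \<open>\<eta>\<close> is a genuine
  inverse.\<close>

lemma valuation_domain_notinD:
  assumes Z: "valuation_domain Z" and "N > 0" and "\<psi> \<notin> Z"
  defines "\<eta> \<equiv> inverse (inverse \<psi> ^ N - 1)"
  shows "inverse \<psi> \<in> Z" "\<eta> \<in> Z" "\<eta> \<noteq> 0"
proof -
  have sub: "subring_of_field Z" and one: "1 \<in> Z"
    using Z by (auto simp: valuation_domain_def subring_of_field_def)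
  have "\<psi> \<noteq> 0"
    using subring_of_field_zero[OF sub] \<open>\<psi> \<notin> Z\<close> by auto
  then show inv: "inverse \<psi> \<in> Z"
    using Z \<open>\<psi> \<notin> Z\<close> by (auto simp: valuation_domain_def)
  have "inverse \<psi> ^ N = inverse \<psi> * inverse \<psi> ^ (N - 1)"
    using \<open>N > 0\<close> by (simp add: power_eq_if)
  \<comment> \<open>So \<open>\<psi> ^ N\<close> in \<open>Z\<close> would put \<open>\<psi>\<close>
    itself in \<open>Z\<close>.\<close>
  then have psi: "\<psi> = inverse \<psi> ^ (N - 1) * inverse (inverse \<psi> ^ N)"
    using \<open>\<psi> \<noteq> 0\<close> by (simp add: field_simps)
  have notin: "inverse (inverse \<psi> ^ N) \<notin> Z"
    using psi subring_of_field_mult[OF sub subring_of_field_power[OF sub inv]] \<open>\<psi> \<notin> Z\<close> by metis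
  then have ne: "inverse \<psi> ^ N - 1 \<noteq> 0"
    using one by auto
  then show "\<eta> \<noteq> 0"
    by (simp add: \<eta>_def)
  let ?y = "1 - inverse \<psi> ^ N"
  have "?y \<in> Z"
    by (intro subring_of_field_diff[OF sub] subring_of_field_power[OF sub] one inv)
  \<comment> \<open>Locality applies to \<open>inverse \<psi> ^ N + ?y = 1\<close>, whose first
    summand is not a unit.\<close>
  then have "inverse ?y \<in> Z"
    using valuation_domain_local[OF Z subring_of_field_power[OF sub inv, of N], of ?y]
      notin ne \<open>\<psi> \<noteq> 0\<close> by auto
  moreover have "\<eta> = 0 - inverse ?y"
    unfolding \<eta>_def by (metis diff_0 inverse_minus_eq minus_diff_eq)
  ultimately show "\<eta> \<in> Z"
    using subring_of_field_diff[OF sub subring_of_field_zero[OF sub]] by metis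
qed

section \<open>Values of a rational function at a point\<close>

lemma ratfun_value_unique:
  assumes "ratfun_value \<phi> a y" "ratfun_value \<phi> a z"
  shows "y = z"
proof -
  obtain p q p' q' where pq: "\<phi> = Fract p q" "poly q a \<noteq> 0" "y = poly p a / poly q a"
    "\<phi> = Fract p' q'" "poly q' a \<noteq> 0" "z = poly p' a / poly q' a"
    using assms unfolding ratfun_value_def by blast
  then have "q \<noteq> 0" "q' \<noteq> 0" by auto
  then have "p * q' = p' * q"
    using pq by (simp add: eq_fract)
  then have "poly p a * poly q' a = poly p' a * poly q a"
    by (metis poly_mult)
  then show ?thesis
    using pq by (simp add: frac_eq_eq)
qed

lemma ratfun_value_Fract: "poly q a \<noteq> 0 \<Longrightarrow> ratfun_value (Fract p q) a (poly p a / poly q a)"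
  unfolding ratfun_value_def by blast

lemma ratfun_value_poly: "ratfun_value (Fract p 1) a (poly p a)"
  using ratfun_value_Fract[of 1 a p] by simp

lemma ratfun_value_one: "ratfun_value 1 a 1"
  using ratfun_value_poly[of 1] by (simp add: One_fract_def)

lemma ratfun_value_diff:
  assumes "ratfun_value \<phi> a y" "ratfun_value \<psi> a z"
  shows "ratfun_value (\<phi> - \<psi>) a (y - z)"
proof -
  obtain p q p' q' where pq: "\<phi> = Fract p q" "poly q a \<noteq> 0" "y = poly p a / poly q a"
    "\<psi> = Fract p' q'" "poly q' a \<noteq> 0" "z = poly p' a / poly q' a"
    using assms unfolding ratfun_value_def by blast
  then have "q \<noteq> 0" "q' \<noteq> 0" by auto
  then have "\<phi> - \<psi> = Fract (p * q' - p' * q) (q * q')"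
    using pq by simp
  moreover have "y - z = poly (p * q' - p' * q) a / poly (q * q') a"
    using pq by (simp add: diff_frac_eq)
  moreover have "poly (q * q') a \<noteq> 0"
    using pq by simp
  ultimately show ?thesis
    by (metis ratfun_value_Fract)
qed

lemma ratfun_value_mult:
  assumes "ratfun_value \<phi> a y" "ratfun_value \<psi> a z"
  shows "ratfun_value (\<phi> * \<psi>) a (y * z)"
proof -
  obtain p q p' q' where pq: "\<phi> = Fract p q" "poly q a \<noteq> 0" "y = poly p a / poly q a"
    "\<psi> = Fract p' q'" "poly q' a \<noteq> 0" "z = poly p' a / poly q' a"
    using assms unfolding ratfun_value_def by blast
  then show ?thesis
    using ratfun_value_Fract[of "q * q'" a "p * p'"] by simp
qed

lemma ratfun_value_power: "ratfun_value \<phi> a y \<Longrightarrow> ratfun_value (\<phi> ^ n) a (y ^ n)"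
  by (induction n) (auto intro: ratfun_value_one ratfun_value_mult)

lemma ratfun_value_inverse:
  assumes "\<phi> \<noteq> 0" "ratfun_value \<phi> a y" "ratfun_value (inverse \<phi>) a z"
  shows "z * y = 1"
  using ratfun_value_mult[OF assms(3,2)] ratfun_value_unique[OF _ ratfun_value_one] assms(1) by simp

lemma fract_poly_nonzero_cases:
  fixes \<phi> :: "'a::field poly fract"
  assumes "\<phi> \<noteq> 0"
  obtains p q where "\<phi> = Fract p q" "p \<noteq> 0" "q \<noteq> 0"
proof (cases \<phi>)
  case (Fract p q)
  then have "p \<noteq> 0"
    using assms by (auto simp: fract_collapse)
  then show ?thesis
    using Fract that by auto
qed

section \<open>Topologies\<close>

text \<open>Thanks to this, the case of a finite residue field need only be treated on one large set
  of points.\<close>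

lemma zar_eq_cons_on_subset:
  assumes "zar_eq_cons_on V S" "S' \<subseteq> S"
  shows "zar_eq_cons_on V S'"
proof -
  have sub: "subtopology T S' = subtopology (subtopology T S) S'" for T
    using assms(2) by (simp add: subtopology_subtopology inf.absorb2)
  show ?thesis
    using assms(1) unfolding zar_eq_cons_on_def
    by (subst (1 2) sub) simp
qed

lemma openin_zariski_Zar_B: "openin (zariski_topology V) (Zar_B V \<phi>)"
  unfolding zariski_topology_def by (rule topology_generated_by_Basis) auto

lemma openin_constructible_complement: "openin (constructible_topology V) (Zar V - Zar_B V \<phi>)"
  unfolding constructible_topology_def
  by (rule topology_generated_by_Basis, rule UN_I[of "{\<phi>}"]) auto

lemma openin_zariski_imp_constructible:
  assumes "openin (zariski_topology V) U"
  shows "openin (constructible_topology V) U"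
proof -
  have B: "openin (constructible_topology V) (Zar_B V \<phi>)" for \<phi>
    unfolding constructible_topology_def
    by (rule topology_generated_by_Basis, rule UN_I[of "{\<phi>}"]) auto
  have "generate_topology_on (range (Zar_B V)) U"
    using assms by (simp add: zariski_topology_def openin_topology_generated_by_iff)
  then show ?thesis
  proof (induction rule: generate_topology_on.induct)
    case (Basis s)
    then show ?case
      using B by auto
  qed auto
qed

text \<open>Finite intersections of subbasic sets form a neighbourhood base, so a Zariski
  neighbourhood of \<open>E\<close> is controlled by finitely many elements of
  \<open>E\<close>.\<close>

lemma openin_zariski_finite_nbhd:
  assumes "openin (zariski_topology V) U" "E \<in> U"
  obtains P where "finite P" "P \<subseteq> E" "\<forall>Z\<in>Zar V. P \<subseteq> Z \<longrightarrow> Z \<in> U"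
proof -
  have "generate_topology_on (range (Zar_B V)) U"
    using assms by (simp add: zariski_topology_def openin_topology_generated_by_iff)
  then have "\<exists>P. finite P \<and> P \<subseteq> E \<and> (\<forall>Z\<in>Zar V. P \<subseteq> Z \<longrightarrow> Z \<in> U)"
    using \<open>E \<in> U\<close>
  proof (induction rule: generate_topology_on.induct)
    case (Int a b)
    then obtain P P' where "finite P" "P \<subseteq> E" "\<forall>Z\<in>Zar V. P \<subseteq> Z \<longrightarrow> Z \<in> a"
      "finite P'" "P' \<subseteq> E" "\<forall>Z\<in>Zar V. P' \<subseteq> Z \<longrightarrow> Z \<in> b" by auto
    then show ?case by (intro exI[of _ "P \<union> P'"]) auto
  next
    case (UN K)
    then obtain k where k: "k \<in> K" "E \<in> k" by auto
    then obtain P where P: "finite P" "P \<subseteq> E" "\<forall>Z\<in>Zar V. P \<subseteq> Z \<longrightarrow> Z \<in> k"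
      using UN.IH by meson
    then show ?case
      using k(1) by (intro exI[of _ P]) auto
  next
    case (Basis s)
    then obtain \<phi> where "s = Zar_B V \<phi>" by auto
    then show ?case
      using Basis.prems by (intro exI[of _ "{\<phi>}"]) (auto simp: Zar_B_def)
  qed auto
  then show ?thesis
    using that by blast
qed

text \<open>By De Morgan, the complement of a finite intersection of subbasic sets is a union of
  complements of single ones. So it suffices that the latter are Zariski open on \<open>S\<close>;
  the Zariski topology is the coarser one in any case.\<close>

lemma zar_eq_cons_onI:
  assumes "\<And>\<psi>. \<exists>U. openin (zariski_topology V) U \<and> U \<inter> S = (Zar V - Zar_B V \<psi>) \<inter> S"
  shows "zar_eq_cons_on V S"
proof -
  from assms obtain U where U: "\<And>\<psi>. openin (zariski_topology V) (U \<psi>)"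
    "\<And>\<psi>. U \<psi> \<inter> S = (Zar V - Zar_B V \<psi>) \<inter> S" by metis
  \<comment> \<open>\<open>T\<close> itself need not be Zariski open, so the induction tracks a
    Zariski open set with the same trace on \<open>S\<close>.\<close>
  have *: "\<exists>T'. openin (zariski_topology V) T' \<and> T' \<inter> S = T \<inter> S"
    if T: "openin (constructible_topology V) T" for T
  proof -
    have "generate_topology_on
        (\<Union>F\<in>{F. finite F \<and> F \<noteq> {}}. {\<Inter> (Zar_B V ` F), Zar V - \<Inter> (Zar_B V ` F)}) T"
      using T by (simp add: constructible_topology_def openin_topology_generated_by_iff)
    then show ?thesis
    proof (induction rule: generate_topology_on.induct)
      case Empty
      show ?case by (intro exI[of _ "{}"]) auto
    next
      case (Int a b)
      then obtain a' b' where "openin (zariski_topology V) a'" "a' \<inter> S = a \<inter> S"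
        "openin (zariski_topology V) b'" "b' \<inter> S = b \<inter> S" by auto
      then show ?case by (intro exI[of _ "a' \<inter> b'"]) auto
    next
      case (UN K)
      then obtain f where "\<And>k. k \<in> K \<Longrightarrow> openin (zariski_topology V) (f k)"
        "\<And>k. k \<in> K \<Longrightarrow> f k \<inter> S = k \<inter> S" by metis
      then show ?case by (intro exI[of _ "\<Union> (f ` K)"]) blast
    next
      case (Basis s)
      then obtain F where F: "finite F" "F \<noteq> {}"
        and s: "s = \<Inter> (Zar_B V ` F) \<or> s = Zar V - \<Inter> (Zar_B V ` F)" by auto
      from s show ?case
      proof
        assume "s = \<Inter> (Zar_B V ` F)"
        then show ?thesis
          using F by (intro exI[of _ s]) (auto intro!: openin_Inter openin_zariski_Zar_B)
      next
        assume "s = Zar V - \<Inter> (Zar_B V ` F)"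
        then have "s \<inter> S = (\<Union>\<psi>\<in>F. (Zar V - Zar_B V \<psi>) \<inter> S)" by auto
        also have "\<dots> = \<Union> (U ` F) \<inter> S"
          using U(2) by auto
        finally show ?thesis
          using U(1) by (intro exI[of _ "\<Union> (U ` F)"]) auto
      qed
    qed
  qed
  show ?thesis
    unfolding zar_eq_cons_on_def topology_eq openin_subtopology
    by (metis * openin_zariski_imp_constructible)
qed

section \<open>Fields with a real valuation\<close>

locale real_valued_field =
  fixes v :: "'a::field \<Rightarrow> ereal" and V :: "'a set"
  assumes real_valuation: "real_valuation_of v V"
begin

text \<open>Pitfall: \<open>w 0 = 0\<close>, whereas \<open>v 0 = \<infinity>\<close>.\<close>

definition w :: "'a \<Rightarrow> real" where "w x = real_of_ereal (v x)"

lemma v_zero: "v 0 = \<infinity>" and v_mult: "v (x * y) = v x + v y"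
  and v_add: "min (v x) (v y) \<le> v (x + y)" and mem_V: "x \<in> V \<longleftrightarrow> 0 \<le> v x"
  using real_valuation unfolding real_valuation_of_def by auto

lemma v_eq_w: "x \<noteq> 0 \<Longrightarrow> v x = ereal (w x)"
  using real_valuation unfolding real_valuation_of_def w_def
  by (cases "v x") auto

lemma w_mult: "x \<noteq> 0 \<Longrightarrow> y \<noteq> 0 \<Longrightarrow> w (x * y) = w x + w y"
  using v_mult[of x y] v_eq_w[of x] v_eq_w[of y] v_eq_w[of "x * y"] by simp

lemma w_one: "w 1 = 0"
  using w_mult[of 1 1] by simp

lemma w_power: "x \<noteq> 0 \<Longrightarrow> w (x ^ n) = n * w x"
  by (induction n) (auto simp: w_one w_mult algebra_simps)

lemma w_inverse: "x \<noteq> 0 \<Longrightarrow> w (inverse x) = - w x"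
  using w_mult[of x "inverse x"] w_one by simp

lemma w_divide: "x \<noteq> 0 \<Longrightarrow> y \<noteq> 0 \<Longrightarrow> w (x / y) = w x - w y"
  using w_mult[of x "inverse y"] w_inverse[of y] by (simp add: divide_inverse)

lemma v_minus: "v (- x) = v x"
proof (cases "x = 0")
  case False
  have "w (-1) + w (-1) = 0"
    using w_mult[of "-1" "-1"] w_one by simp
  then show ?thesis
    using False w_mult[of "-1" x] by (simp add: v_eq_w)
qed simp

lemma v_diff: "min (v x) (v y) \<le> v (x - y)"
  using v_add[of x "- y"] by (simp add: v_minus)

text \<open>Writing \<open>x\<close> as \<open>(x + y) - y\<close> and applying the ultrametric
  inequality once more gives the reverse bound.\<close>

lemma v_add_eq:
  assumes "v x < v y"
  shows "v (x + y) = v x" and "v (y + x) = v x"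
proof -
  have "v x \<le> v (x + y)"
    using v_add[of x y] assms by (metis min.absorb3)
  moreover have "min (v (x + y)) (v y) \<le> v x"
    using v_diff[of "x + y" y] by simp
  ultimately show "v (x + y) = v x"
    using assms by (metis min_def order_antisym_conv leD)
  then show "v (y + x) = v x"
    by (simp add: add.commute)
qed

lemma mem_max_ideal: "x \<in> max_ideal V \<longleftrightarrow> 0 < v x"
  by (cases "x = 0")
    (auto simp: max_ideal_def mem_V v_zero v_eq_w w_inverse zero_ereal_def)

lemma subring_V: "subring_of_field V"
proof -
  have "x - y \<in> V" if "x \<in> V" "y \<in> V" for x y
    using v_diff[of x y] that by (auto simp: mem_V min_def split: if_splits intro: order_trans)
  then show ?thesis
    unfolding subring_of_field_def by (simp add: mem_V v_mult) (simp add: v_eq_w w_one)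
qed

lemma max_ideal_add: "x \<in> max_ideal V \<Longrightarrow> y \<in> max_ideal V \<Longrightarrow> x + y \<in> max_ideal V"
  using v_add[of x y] by (auto simp: mem_max_ideal min_def split: if_splits)

lemma max_ideal_diff: "x \<in> max_ideal V \<Longrightarrow> y \<in> max_ideal V \<Longrightarrow> x - y \<in> max_ideal V"
  using max_ideal_add[of x "- y"] by (simp add: mem_max_ideal v_minus)

lemma max_ideal_mult: "x \<in> max_ideal V \<Longrightarrow> y \<in> V \<Longrightarrow> x * y \<in> max_ideal V"
  by (simp add: mem_max_ideal mem_V v_mult add_pos_nonneg)

lemma max_ideal_prime:
  "x * y \<in> max_ideal V \<Longrightarrow> x \<in> V \<Longrightarrow> y \<in> V \<Longrightarrow> x \<in> max_ideal V \<or> y \<in> max_ideal V"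
  by (auto simp: mem_max_ideal mem_V v_mult order_le_less)

lemma max_ideal_subset: "x \<in> max_ideal V \<Longrightarrow> x \<in> V"
  by (simp add: max_ideal_def)

lemma one_notin_max_ideal: "1 \<notin> max_ideal V"
  by (simp add: mem_max_ideal v_eq_w w_one)

lemma equiv_residue: "equiv V {(x, y). x \<in> V \<and> y \<in> V \<and> x - y \<in> max_ideal V}"
proof (rule equivI)
  show "refl_on V {(x, y). x \<in> V \<and> y \<in> V \<and> x - y \<in> max_ideal V}"
    by (auto simp: refl_on_def mem_max_ideal v_zero)
  show "sym {(x, y). x \<in> V \<and> y \<in> V \<and> x - y \<in> max_ideal V}"
    by (auto simp: sym_def mem_max_ideal) (metis minus_diff_eq v_minus)
  show "trans {(x, y). x \<in> V \<and> y \<in> V \<and> x - y \<in> max_ideal V}"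
    using max_ideal_add by (fastforce simp: trans_def)
qed auto

lemma poly_in_V: "(\<And>k. coeff p k \<in> V) \<Longrightarrow> u \<in> V \<Longrightarrow> poly p u \<in> V"
  unfolding poly_altdef
  by (intro subring_of_field_sum subring_of_field_mult subring_of_field_power subring_V) auto

section \<open>Finite residue field\<close>

text \<open>The unit group of the residue field is finite. Taking the factorial of the number of
  residue classes as exponent, instead of the group order, lets a pigeonhole argument on powers
  suffice, without a ring structure on the quotient.\<close>

lemma finite_residue_field_exponent:
  assumes "finite (residue_field V)"
  obtains N :: nat where "N > 0" "\<And>y. y \<in> V \<Longrightarrow> y \<notin> max_ideal V \<Longrightarrow> y ^ N - 1 \<in> max_ideal V"
proof
  let ?R = "{(x, y). x \<in> V \<and> y \<in> V \<and> x - y \<in> max_ideal V}"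
  let ?q = "card (residue_field V)"
  show "fact ?q > (0::nat)" by simp
  fix y assume y: "y \<in> V" "y \<notin> max_ideal V"
  have yV: "y ^ i \<in> V" for i
    by (rule subring_of_field_power[OF subring_V y(1)])
  have yM: "y ^ i \<notin> max_ideal V" for i
  proof (induction i)
    case (Suc i)
    then show ?case
      using max_ideal_prime[OF _ y(1) yV[of i]] y(2) by auto
  qed (simp add: one_notin_max_ideal)
  have img: "(\<lambda>i. ?R `` {y ^ i}) ` {..?q} \<subseteq> residue_field V"
    unfolding residue_field_def using yV by (intro image_subsetI quotientI)
  \<comment> \<open>The \<open>?q + 1\<close> powers meet at most \<open>?q\<close> classes.\<close>
  have "\<not> inj_on (\<lambda>i. ?R `` {y ^ i}) {..?q}"
  proof
    assume "inj_on (\<lambda>i. ?R `` {y ^ i}) {..?q}"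
    then have "card {..?q} \<le> ?q"
      using card_inj_on_le[OF _ img assms] by blast
    then show False by simp
  qed
  then obtain k l where kl: "k \<le> ?q" "l \<le> ?q" "k \<noteq> l" "?R `` {y ^ k} = ?R `` {y ^ l}"
    unfolding inj_on_def by auto
  define i j where "i = min k l" and "j = max k l"
  have ij: "i < j" "j \<le> ?q" "?R `` {y ^ i} = ?R `` {y ^ j}"
    using kl by (auto simp: i_def j_def min_def max_def)
  from ij(3) have "y ^ j - y ^ i \<in> max_ideal V"
    using eq_equiv_class_iff[OF equiv_residue yV[of j] yV[of i]] by simp
  \<comment> \<open>The factor \<open>y ^ i\<close> lies outside the maximal ideal, which is prime,
    so it can be cancelled.\<close>
  moreover have "y ^ j - y ^ i = (y ^ (j - i) - 1) * y ^ i"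
    using ij by (simp add: algebra_simps flip: power_add)
  moreover have "y ^ (j - i) - 1 \<in> V"
    using yV[of "j - i"] yV[of 0] subring_of_field_diff[OF subring_V] by simp
  ultimately have M: "y ^ (j - i) - 1 \<in> max_ideal V"
    using max_ideal_prime[OF _ _ yV] yM by simp
  \<comment> \<open>The difference \<open>j - i\<close> depends on \<open>y\<close>, but it is at
    most \<open>?q\<close> and so divides one common exponent; the geometric sum below carries the
    congruence over.\<close>
  have "j - i dvd fact ?q"
    using ij by (intro dvd_fact) auto
  then obtain m where m: "fact ?q = (j - i) * m" ..
  have "y ^ fact ?q - 1 = (y ^ (j - i) - 1) * (\<Sum>k<m. (y ^ (j - i)) ^ k)"
    unfolding m power_mult by (rule power_diff_1_eq)
  moreover have "(\<Sum>k<m. (y ^ (j - i)) ^ k) \<in> V"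
    by (intro subring_of_field_sum subring_of_field_power[OF subring_V] subring_V y)
  ultimately show "y ^ fact ?q - 1 \<in> max_ideal V"
    using max_ideal_mult[OF M] by simp
qed

text \<open>If \<open>\<psi>\<close> were a member too, \<open>inverse \<psi>\<close> would have a
  unit value \<open>y\<close> at some \<open>s n\<close>, so \<open>y ^ N - 1\<close> would lie in
  the maximal ideal. But \<open>\<eta>\<close> has a value in \<open>V\<close> there, which makes
  \<open>y ^ N - 1\<close> a unit.\<close>

lemma V_seq_notinI:
  assumes N: "\<And>y. y \<in> V \<Longrightarrow> y \<notin> max_ideal V \<Longrightarrow> y ^ N - 1 \<in> max_ideal V"
    and "\<psi> \<noteq> 0"
  defines "\<eta> \<equiv> inverse (inverse \<psi> ^ N - 1)"
  assumes phi: "inverse \<psi> \<in> V_seq V s" and chi: "\<eta> \<in> V_seq V s" "\<eta> \<noteq> 0"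
  shows "\<psi> \<notin> V_seq V s"
proof
  assume "\<psi> \<in> V_seq V s"
  then have "\<forall>\<^sub>\<infinity>n. (\<exists>y\<in>V. ratfun_value (inverse \<psi>) (s n) y) \<and>
      (\<exists>y\<in>V. ratfun_value \<eta> (s n) y) \<and> (\<exists>y\<in>V. ratfun_value \<psi> (s n) y)"
    using phi chi unfolding V_seq_def MOST_conj_distrib by simp
  \<comment> \<open>Three conditions that hold for almost all indices hold together at some
    index.\<close>
  then obtain n where "(\<exists>y\<in>V. ratfun_value (inverse \<psi>) (s n) y) \<and>
      (\<exists>y\<in>V. ratfun_value \<eta> (s n) y) \<and> (\<exists>y\<in>V. ratfun_value \<psi> (s n) y)"
    unfolding MOST_nat by (meson lessI)
  then obtain y z x where yzx: "y \<in> V" "z \<in> V" "x \<in> V" "ratfun_value (inverse \<psi>) (s n) y"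
    "ratfun_value \<eta> (s n) z" "ratfun_value \<psi> (s n) x"
    by blast
  have "ratfun_value (inverse \<psi> ^ N - 1) (s n) (y ^ N - 1)"
    by (intro ratfun_value_diff ratfun_value_power ratfun_value_one yzx)
  moreover have "inverse \<psi> ^ N - 1 \<noteq> 0"
    using chi(2) unfolding \<eta>_def by auto
  ultimately have "(y ^ N - 1) * z = 1"
    using ratfun_value_inverse[OF _ _ yzx(5)[unfolded \<eta>_def]] by (subst mult.commute) blast
  then have "y ^ N - 1 \<notin> max_ideal V"
    using max_ideal_mult[of "y ^ N - 1" z] yzx one_notin_max_ideal by auto
  then have "y \<in> max_ideal V"
    using N yzx by blast
  moreover have "y * x = 1"
    by (rule ratfun_value_inverse[OF \<open>\<psi> \<noteq> 0\<close> yzx(6,4)])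
  ultimately show False
    using max_ideal_mult[of y x] yzx one_notin_max_ideal by auto
qed

text \<open>The set \<open>range (V_seq V)\<close> contains every family in the theorem. Its members
  need not all lie in \<open>Zar V\<close>, so both sets compared are kept inside
  \<open>Zar V\<close>.\<close>

lemma finite_residue_field_imp_zar_eq_cons:
  assumes "finite (residue_field V)"
  shows "zar_eq_cons_on V (range (V_seq V))"
proof (rule zar_eq_cons_onI)
  fix \<psi> :: "'a poly fract"
  obtain N :: nat where N: "N > 0"
    "\<And>y. y \<in> V \<Longrightarrow> y \<notin> max_ideal V \<Longrightarrow> y ^ N - 1 \<in> max_ideal V"
    using finite_residue_field_exponent[OF assms] by blast
  define \<eta> where "\<eta> = inverse (inverse \<psi> ^ N - 1)"
  \<comment> \<open>If \<open>\<psi> = 0\<close> or \<open>\<eta> = 0\<close>, every valuation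
    domain contains \<open>\<psi>\<close>, so the set to be matched is empty.\<close>
  define U where "U = (if \<psi> = 0 \<or> \<eta> = 0 then {} else Zar_B V (inverse \<psi>) \<inter> Zar_B V \<eta>)"
  have "openin (zariski_topology V) U"
    by (auto simp: U_def openin_zariski_Zar_B)
  moreover have U_sub: "U \<subseteq> Zar V"
    by (auto simp: U_def Zar_B_def)
  moreover have "Z \<in> U \<longleftrightarrow> \<psi> \<notin> Z" if Z: "Z \<in> Zar V" "Z \<in> range (V_seq V)" for Z
  proof
    show "\<psi> \<notin> Z" if "Z \<in> U"
      using V_seq_notinI[OF N(2), of \<psi>] that Z unfolding \<eta>_def U_def Zar_B_def
      by (auto split: if_splits)
    have vd: "valuation_domain Z"
      using Z by (simp add: Zar_def)
    then have "0 \<in> Z"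
      by (auto simp: valuation_domain_def subring_of_field_zero)
    then show "Z \<in> U" if "\<psi> \<notin> Z"
      using valuation_domain_notinD[OF vd N(1) that] that Z
      by (auto simp: U_def \<eta>_def Zar_B_def)
  qed
  then have "U \<inter> range (V_seq V) = (Zar V - Zar_B V \<psi>) \<inter> range (V_seq V)"
    using U_sub by (auto simp: Zar_B_def)
  ultimately show "\<exists>U. openin (zariski_topology V) U \<and>
      U \<inter> range (V_seq V) = (Zar V - Zar_B V \<psi>) \<inter> range (V_seq V)"
    by blast
qed

section \<open>Infinite residue field\<close>

lemma coeff_synthetic_div_in_V:
  "(\<And>k. coeff p k \<in> V) \<Longrightarrow> a \<in> V \<Longrightarrow> coeff (synthetic_div p a) k \<in> V"
proof (induction p arbitrary: k)
  case 0
  then show ?case by simp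
next
  case (pCons c p)
  have "coeff p k \<in> V" for k
    using pCons.prems(1)[of "Suc k"] by simp
  \<comment> \<open>Horner's scheme: the coefficients of the quotient by \<open>X - a\<close> are
    values at \<open>a\<close> of tails of the polynomial.\<close>
  then show ?case
    using pCons.IH pCons.prems(2) poly_in_V[of p a] by (simp add: coeff_pCons split: nat.split)
qed

text \<open>A nonzero polynomial over the residue field has finitely many roots. The usual
  induction, splitting off \<open>X - a\<close>, is carried out on lifts to \<open>V\<close>;
  \<open>coeff p k0\<close> witnesses that the reduction is nonzero.\<close>

lemma roots_mod_max_ideal:
  assumes "\<And>k. coeff p k \<in> V" "coeff p k0 \<notin> max_ideal V"
  shows "\<exists>A. finite A \<and> (\<forall>u\<in>V. poly p u \<in> max_ideal V \<longrightarrow> (\<exists>a\<in>A. u - a \<in> max_ideal V))"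
  using assms
proof (induction "degree p" arbitrary: p k0 rule: less_induct)
  case less
  show ?case
  proof (cases "\<exists>a\<in>V. poly p a \<in> max_ideal V")
    case False
    then show ?thesis by (intro exI[of _ "{}"]) auto
  next
    case True
    then obtain a where a: "a \<in> V" "poly p a \<in> max_ideal V" by blast
    let ?q = "synthetic_div p a"
    have p: "[:- a, 1:] * ?q + [:poly p a:] = p"
      by (rule synthetic_div_correct')
    have qV: "coeff ?q k \<in> V" for k
      by (rule coeff_synthetic_div_in_V[OF less.prems(1) a(1)])
    \<comment> \<open>Otherwise \<open>p\<close>, which is \<open>(X - a) * ?q\<close> plus the
      constant \<open>poly p a\<close>, would reduce to 0.\<close>
    have "\<exists>k. coeff ?q k \<notin> max_ideal V"
    proof (rule ccontr)
      assume "\<not> ?thesis"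
      then have q: "coeff ?q k \<in> max_ideal V" for k by auto
      have "coeff ([:- a, 1:] * ?q + [:poly p a:]) k \<in> max_ideal V" for k
        using q a max_ideal_mult[OF q a(1)]
        by (cases k) (auto simp: mult.commute[of _ a] algebra_simps
            intro!: max_ideal_add max_ideal_diff)
      then show False
        using less.prems(2) unfolding p by blast
    qed
    then obtain k1 where k1: "coeff ?q k1 \<notin> max_ideal V" by blast
    \<comment> \<open>A constant whose value lies in the maximal ideal reduces to 0. Positive degree
      is what makes the degree of the quotient drop.\<close>
    have "degree p \<noteq> 0"
    proof
      assume "degree p = 0"
      then obtain c where "p = [:c:]"
        by (rule degree_eq_zeroE)
      then show False
        using less.prems(2) a(2) by (cases k0) (auto simp: mem_max_ideal v_zero)
    qed
    then have "degree ?q < degree p"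
      by (simp add: degree_synthetic_div)
    from less.hyps[OF this qV k1] obtain A where A: "finite A"
      "\<forall>u\<in>V. poly ?q u \<in> max_ideal V \<longrightarrow> (\<exists>a\<in>A. u - a \<in> max_ideal V)" by blast
    have "\<exists>b\<in>insert a A. u - b \<in> max_ideal V" if u: "u \<in> V" "poly p u \<in> max_ideal V" for u
    proof -
      have "poly p u = (u - a) * poly ?q u + poly p a"
        by (subst p[symmetric]) (simp add: algebra_simps)
      then have "(u - a) * poly ?q u \<in> max_ideal V"
        using max_ideal_diff[OF u(2) a(2)] by simp
      then have "u - a \<in> max_ideal V \<or> poly ?q u \<in> max_ideal V"
        using max_ideal_prime subring_of_field_diff[OF subring_V u(1) a(1)] poly_in_V[OF qV u(1)]
        by blast
      then show ?thesis
        using A u by auto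
    qed
    then show ?thesis
      using A(1) by (intro exI[of _ "insert a A"]) auto
  qed
qed

text \<open>Otherwise the classes of the elements of \<open>A\<close> would exhaust the residue
  field.\<close>

lemma infinite_residue_field_avoid:
  assumes "infinite (residue_field V)" "finite A"
  obtains u where "u \<in> V" "\<forall>a\<in>A. u - a \<notin> max_ideal V"
proof -
  let ?R = "{(x, y). x \<in> V \<and> y \<in> V \<and> x - y \<in> max_ideal V}"
  have "\<exists>u\<in>V. \<forall>a\<in>A. u - a \<notin> max_ideal V"
  proof (rule ccontr)
    assume *: "\<not> ?thesis"
    have "residue_field V \<subseteq> (\<lambda>a. ?R `` {a}) ` A"
    proof
      fix C assume "C \<in> residue_field V"
      then obtain u where u: "u \<in> V" "C = ?R `` {u}"
        unfolding residue_field_def by (auto elim: quotientE)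
      with * obtain a where a: "a \<in> A" "u - a \<in> max_ideal V" by blast
      \<comment> \<open>An element of \<open>A\<close> may lie outside \<open>V\<close>, but not one
        that is congruent to \<open>u\<close>.\<close>
      have "a = u - (u - a)" by simp
      then have "a \<in> V"
        using subring_of_field_diff[OF subring_V u(1)] max_ideal_subset[OF a(2)] by metis
      then have "?R `` {u} = ?R `` {a}"
        using u a by (intro equiv_class_eq[OF equiv_residue]) auto
      then show "C \<in> (\<lambda>a. ?R `` {a}) ` A"
        using u a by auto
    qed
    then show False
      using assms finite_surj by blast
  qed
  then show ?thesis
    using that by blast
qed

section \<open>Nontriviality and density of the value group\<close>

lemma krull_dim_imp_nontrivial:
  assumes "krull_dim V = 1"
  obtains g where "g \<noteq> 0" "w g > 0"
proof -
  have "\<exists>g. g \<noteq> 0 \<and> w g > 0"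
  proof (rule ccontr)
    assume "\<not> ?thesis"
    then have le: "w x \<le> 0" if "x \<noteq> 0" for x
      using that by force
    have "w x = 0" if "x \<noteq> 0" for x
      using le[of x] le[of "inverse x"] w_inverse[of x] that by simp
    then have V: "x \<in> V" for x
      by (cases "x = 0") (auto simp: mem_V v_zero v_eq_w zero_ereal_def)
    \<comment> \<open>Here \<open>V\<close> is the whole field, so a nonzero ideal is everything;
      with \<open>{0}\<close> as the only prime ideal the dimension would be 0.\<close>
    have prime: "P = {0}" if P: "prime_ideal_in V P" for P
    proof -
      have I: "ideal_in V P" and "P \<noteq> V"
        using P by (auto simp: prime_ideal_in_def)
      have "x = 0" if "x \<in> P" for x
      proof (rule ccontr)
        assume "x \<noteq> 0"
        have "y \<in> P" for y
        proof -
          have "(y / x) * x \<in> P"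
            using I V \<open>x \<in> P\<close> unfolding ideal_in_def by blast
          then show ?thesis
            using \<open>x \<noteq> 0\<close> by simp
        qed
        then show False
          using \<open>P \<noteq> V\<close> V by blast
      qed
      then show ?thesis
        using I by (auto simp: ideal_in_def)
    qed
    have "n = 0" if "\<forall>i\<le>n. prime_ideal_in V (P i)" "\<forall>i<n. P i \<subset> P (Suc i)" for n :: nat and P
    proof (rule ccontr)
      assume "n \<noteq> 0"
      then have "P 0 \<subset> P (Suc 0)" "P 0 = {0}" "P (Suc 0) = {0}"
        using that prime by auto
      then show False by simp
    qed
    then have "krull_dim V \<le> 0"
      unfolding krull_dim_def by (intro SUP_least) (auto simp: zero_enat_def)
    then show False
      using assms by simp
  qed
  then show ?thesis
    using that by blast
qed

text \<open>A nontrivial subgroup of the reals whose positive elements stay away from 0 is generated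
  by the least of them.\<close>

lemma not_discrete_imp_small_values:
  assumes "\<not> discrete_valuation v" "g0 \<noteq> 0" "w g0 > 0" "\<epsilon> > 0"
  obtains x where "x \<noteq> 0" "0 < w x" "w x < \<epsilon>"
proof -
  have "\<exists>x. x \<noteq> 0 \<and> 0 < w x \<and> w x < \<epsilon>"
  proof (rule ccontr)
    assume "\<not> ?thesis"
    then have ge: "\<epsilon> \<le> w x" if "x \<noteq> 0" "0 < w x" for x
      using that by force
    define P where "P = w ` {x. x \<noteq> 0 \<and> w x > 0}"
    have "P \<noteq> {}"
      using assms unfolding P_def by auto
    have "bdd_below P"
      unfolding P_def by (rule bdd_belowI[of _ 0]) auto
    have "Inf P < Inf P + \<epsilon>"
      using \<open>\<epsilon> > 0\<close> by simp
    then obtain g where g: "g \<noteq> 0" "w g > 0" "w g < Inf P + \<epsilon>"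
      using cInf_lessD[OF \<open>P \<noteq> {}\<close>] unfolding P_def by blast
    \<comment> \<open>A positive value below \<open>w g\<close> would differ from it by less than
      \<open>\<epsilon>\<close>, and the difference would itself be a positive value.\<close>
    have min: "w g \<le> w y" if "y \<noteq> 0" "w y > 0" for y
    proof (rule ccontr)
      assume "\<not> ?thesis"
      moreover have "Inf P \<le> w y"
        using \<open>bdd_below P\<close> that by (intro cInf_lower) (auto simp: P_def)
      ultimately show False
        using ge[of "g / y"] g that by (simp add: w_divide)
    qed
    have pow: "w (g powi n) = n * w g" for n :: int
      using g by (cases "n \<ge> 0") (auto simp: power_int_def w_power w_inverse)
    have "value_group v = range (\<lambda>n::int. of_int n * w g)"
    proof (intro subset_antisym subsetI)
      fix r assume "r \<in> value_group v"
      then obtain x where x: "x \<noteq> 0" "r = w x"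
        by (auto simp: value_group_def v_eq_w)
      \<comment> \<open>Division with remainder by \<open>w g\<close>: the remainder is a value in
        \<open>[0, w g)\<close>, so minimality makes it 0.\<close>
      define n where "n = \<lfloor>w x / w g\<rfloor>"
      have "of_int n \<le> w x / w g" "w x / w g < of_int n + 1"
        unfolding n_def by linarith+
      then have "of_int n * w g \<le> w x" "w x < of_int n * w g + w g"
        using g by (auto simp: field_simps)
      moreover have "w (x / g powi n) = w x - n * w g"
        using x g by (simp add: w_divide pow)
      ultimately have "w x = n * w g"
        using min[of "x / g powi n"] x g by (cases "w x = n * w g") auto
      then show "r \<in> range (\<lambda>n::int. of_int n * w g)"
        using x by auto
    next
      fix r assume "r \<in> range (\<lambda>n::int. of_int n * w g)"
      then obtain n :: int where "r = n * w g" by auto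
      then show "r \<in> value_group v"
        unfolding value_group_def using g pow[of n]
        by (auto intro!: exI[of _ "g powi n"] simp: v_eq_w)
    qed
    then show False
      using assms(1) g unfolding discrete_valuation_def by blast
  qed
  then show ?thesis
    using that by blast
qed

text \<open>The terms are inverses of elements of small positive value, chosen recursively with a
  bound that forces the limit.\<close>

lemma exists_seq_values_to_zero:
  assumes "\<not> discrete_valuation v" "g0 \<noteq> 0" "w g0 > 0"
  obtains x where "\<And>n. x n \<noteq> 0" "\<And>n. w (x n) < 0" "strict_mono (\<lambda>n. w (x n))"
    "(\<lambda>n. w (x n)) \<longlonglongrightarrow> 0"
proof -
  have ex: "\<exists>y. y \<noteq> 0 \<and> - \<epsilon> < w y \<and> w y < 0" if "\<epsilon> > 0" for \<epsilon>
  proof -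
    obtain y where "y \<noteq> 0" "0 < w y" "w y < \<epsilon>"
      using not_discrete_imp_small_values[OF assms \<open>\<epsilon> > 0\<close>] by blast
    then show ?thesis
      by (intro exI[of _ "inverse y"]) (auto simp: w_inverse)
  qed
  have "\<exists>x. \<forall>n. (x n \<noteq> 0 \<and> w (x n) < 0 \<and> - inverse (Suc n) < w (x n)) \<and> w (x n) < w (x (Suc n))"
  proof (rule dependent_nat_choice)
    show "\<exists>y. y \<noteq> 0 \<and> w y < 0 \<and> - inverse (real (Suc 0)) < w y"
      using ex[of 1] by auto
    fix y n assume y: "y \<noteq> 0 \<and> w y < 0 \<and> - inverse (real (Suc n)) < w y"
    \<comment> \<open>Beating this minimum secures both the next bound and the strict
      increase.\<close>
    then have "min (inverse (real (Suc (Suc n)))) (- w y) > 0" by simp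
    from ex[OF this] obtain z where
      "z \<noteq> 0" "- min (inverse (real (Suc (Suc n)))) (- w y) < w z" "w z < 0" by blast
    then show "\<exists>z. (z \<noteq> 0 \<and> w z < 0 \<and> - inverse (real (Suc (Suc n))) < w z) \<and> w y < w z"
      by (intro exI[of _ z]) linarith
  qed
  then obtain x where x: "\<And>n. x n \<noteq> 0" "\<And>n. w (x n) < 0"
    "\<And>n. - inverse (real (Suc n)) < w (x n)" "\<And>n. w (x n) < w (x (Suc n))" by blast
  have "(\<lambda>n. - inverse (real (Suc n))) \<longlonglongrightarrow> 0"
    using tendsto_minus[OF LIMSEQ_inverse_real_of_nat] by simp
  from tendsto_sandwich[OF _ _ this tendsto_const, of "\<lambda>n. w (x n)"]
  have "(\<lambda>n. w (x n)) \<longlonglongrightarrow> 0"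
    using x(2,3) by (simp add: less_imp_le)
  then show ?thesis
    using that[of x] x by (simp add: strict_mono_Suc_iff)
qed

end

section \<open>Valuation domains attached to the affine images of one sequence\<close>

locale real_valued_field_seq = real_valued_field +
  fixes x :: "nat \<Rightarrow> 'a"
  assumes x_nonzero: "x n \<noteq> 0" and w_x_neg: "w (x n) < 0"
    and w_x_mono: "strict_mono (\<lambda>n. w (x n))" and w_x_lim: "(\<lambda>n. w (x n)) \<longlonglongrightarrow> 0"
begin

text \<open>Successive differences of \<open>a + d * x n\<close> have value
  \<open>w d + w (x n)\<close>, which increases to \<open>w d\<close>. So \<open>d\<close>
  prescribes the breadth, and \<open>a\<close> only translates.\<close>

abbreviation W :: "'a \<Rightarrow> 'a \<Rightarrow> 'a poly fract set" where
  "W a d \<equiv> V_seq V (\<lambda>n. a + d * x n)"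

lemma v_monomial: "e \<noteq> 0 \<Longrightarrow> v (e * x n ^ i) = ereal (w e + i * w (x n))"
  using x_nonzero by (simp add: v_eq_w w_mult w_power)

lemma v_monomial_lim: "e \<noteq> 0 \<Longrightarrow> (\<lambda>n. w e + real i * w (x n)) \<longlonglongrightarrow> w e"
  using tendsto_add[OF tendsto_const tendsto_mult[OF tendsto_const w_x_lim], of "w e" "real i"]
  by simp

text \<open>Since \<open>w (x n)\<close> tends to 0, the exponents do not matter in the limit and a
  strict gap between the coefficients persists.\<close>

lemma eventually_v_monomial_less:
  assumes "e \<noteq> 0" "e' \<noteq> 0" "w e < w e'"
  shows "\<forall>\<^sub>F n in sequentially. v (e * x n ^ i) < v (e' * x n ^ j)"
proof -
  obtain r where r: "w e < r" "r < w e'"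
    using assms dense by blast
  show ?thesis
    using order_tendstoD(2)[OF v_monomial_lim[OF assms(1)] r(1), of i]
      order_tendstoD(1)[OF v_monomial_lim[OF assms(2)] r(2), of j]
    by eventually_elim (use assms in \<open>auto simp: v_monomial\<close>)
qed

lemma v_monomial_eq_le:
  assumes "e \<noteq> 0" "e' \<noteq> 0" "w e = w e'" "i \<le> j"
  shows "v (e' * x n ^ j) \<le> v (e * x n ^ i)"
  using assms w_x_neg[of n] by (simp add: v_monomial mult_right_mono_neg less_imp_le)

text \<open>The coefficients decide, and exponents break ties because \<open>w (x n)\<close> is
  negative. The outcome does not oscillate with \<open>n\<close>, which is what makes
  \<open>W a d\<close> a valuation domain.\<close>

lemma eventually_v_monomial_cmp:
  assumes "e \<noteq> 0" "e' \<noteq> 0"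
  shows "(\<forall>\<^sub>F n in sequentially. v (e * x n ^ i) \<le> v (e' * x n ^ j)) \<or>
         (\<forall>\<^sub>F n in sequentially. v (e' * x n ^ j) \<le> v (e * x n ^ i))"
proof -
  consider "w e < w e'" | "w e' < w e" | "w e = w e'" "i \<le> j" | "w e = w e'" "j \<le> i"
    by linarith
  then show ?thesis
  proof cases
    case 1
    have "\<forall>\<^sub>F n in sequentially. v (e * x n ^ i) \<le> v (e' * x n ^ j)"
      using eventually_v_monomial_less[OF assms 1] by eventually_elim (rule less_imp_le)
    then show ?thesis ..
  next
    case 2
    have "\<forall>\<^sub>F n in sequentially. v (e' * x n ^ j) \<le> v (e * x n ^ i)"
      using eventually_v_monomial_less[OF assms(2,1) 2] by eventually_elim (rule less_imp_le)
    then show ?thesis ..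
  next
    case 3
    then show ?thesis
      using v_monomial_eq_le[OF assms] by simp
  next
    case 4
    then show ?thesis
      using v_monomial_eq_le[OF assms(2,1)] by simp
  qed
qed

text \<open>
  As \<open>w (x n)\<close> tends to \<open>0\<close> from below, the dominating term of \<open>poly p (x n)\<close> is the one of highest
  degree among those whose coefficient has the least value.
\<close>

lemma poly_dominating_term:
  assumes "p \<noteq> 0"
  shows "\<exists>e i. e \<noteq> 0 \<and> e \<in> range (coeff p) \<and> (\<forall>k. v e \<le> v (coeff p k)) \<and>
    (\<forall>\<^sub>F n in sequentially. v (poly p (x n)) = v (e * x n ^ i))"
  using assms
proof (induction p)
  case 0
  then show ?case by simp
next
  case (pCons a p)
  show ?case
  proof (cases "p = 0")
    case True
    with pCons.hyps have "a \<noteq> 0" by simp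
    then show ?thesis
      using True by (intro exI[of _ a] exI[of _ 0])
        (auto simp: coeff_pCons v_zero split: nat.split intro!: image_eqI[of _ _ 0])
  next
    case False
    then obtain e i where e: "e \<noteq> 0" "e \<in> range (coeff p)" "\<And>k. v e \<le> v (coeff p k)"
      and ev: "\<forall>\<^sub>F n in sequentially. v (poly p (x n)) = v (e * x n ^ i)"
      using pCons.IH by blast
    have ev': "\<forall>\<^sub>F n in sequentially. v (x n * poly p (x n)) = v (e * x n ^ Suc i)"
      using ev by eventually_elim (simp add: v_mult ac_simps)
    show ?thesis
    proof (cases "v a < v e")
      case True
      then have "a \<noteq> 0"
        by (auto simp: v_zero)
      with True e have "w a < w e"
        by (simp add: v_eq_w)
      have "\<forall>\<^sub>F n in sequentially. v (poly (pCons a p) (x n)) = v (a * x n ^ 0)"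
        using eventually_v_monomial_less[OF \<open>a \<noteq> 0\<close> e(1) \<open>w a < w e\<close>, of 0 "Suc i"] ev'
        by eventually_elim (simp add: v_add_eq)
      moreover have "v a \<le> v (coeff (pCons a p) k)" for k
        using less_imp_le[OF less_le_trans[OF True e(3)]] by (cases k) auto
      moreover have "a \<in> range (coeff (pCons a p))"
        by (intro image_eqI[of _ _ 0]) auto
      ultimately show ?thesis
        using \<open>a \<noteq> 0\<close> by blast
    next
      case False
      \<comment> \<open>Even in a tie \<open>v a = v e\<close>, the extra factor \<open>x n\<close>
        of negative value keeps the shifted term strictly below \<open>a\<close>.\<close>
      have less: "v (e * x n ^ Suc i) < v a" for n
      proof -
        have "v (e * x n ^ Suc i) < v e"
          using e w_x_neg[of n] unfolding v_monomial[OF e(1)]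
          by (simp add: v_eq_w mult_pos_neg)
        then show ?thesis
          using False by simp
      qed
      have "\<forall>\<^sub>F n in sequentially. v (poly (pCons a p) (x n)) = v (e * x n ^ Suc i)"
        using ev'
      proof eventually_elim
        case (elim n)
        then show ?case
          using less[of n] v_add_eq(2)[of "x n * poly p (x n)" a] by simp
      qed
      moreover have "v e \<le> v (coeff (pCons a p) k)" for k
        using False e(3) by (cases k) auto
      moreover have "e \<in> range (coeff (pCons a p))"
        using e(2) by (auto intro: rev_image_eqI[of "Suc _"])
      ultimately show ?thesis
        using e(1) by blast
    qed
  qed
qed

lemma pcompose_affine_nonzero: "(q::'a poly) \<noteq> 0 \<Longrightarrow> d \<noteq> 0 \<Longrightarrow> q \<circ>\<^sub>p [:a, d:] \<noteq> 0"
  by (auto dest: pcompose_eq_0)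

lemma poly_pcompose_affine: "poly (q \<circ>\<^sub>p [:a, d:]) t = poly q (a + d * t)"
  by (simp add: poly_pcompose mult.commute)

text \<open>Numerator and denominator eventually have the values of monomials in \<open>x n\<close>,
  and these are eventually comparable.\<close>

lemma W_valuation_domain:
  assumes "d \<noteq> 0"
  shows "valuation_domain (W a d)"
proof -
  have "subring_of_field (W a d)"
  proof -
    have "1 \<in> V"
      using subring_V by (simp add: subring_of_field_def)
    then have "1 \<in> W a d"
      using ratfun_value_one by (auto simp: V_seq_def intro!: MOST_I)
    moreover have "\<phi> - \<psi> \<in> W a d" if "\<phi> \<in> W a d" "\<psi> \<in> W a d" for \<phi> \<psi>
      using that unfolding V_seq_def mem_Collect_eq
      by eventually_elim (metis ratfun_value_diff subring_of_field_diff subring_V)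
    moreover have "\<phi> * \<psi> \<in> W a d" if "\<phi> \<in> W a d" "\<psi> \<in> W a d" for \<phi> \<psi>
      using that unfolding V_seq_def mem_Collect_eq
      by eventually_elim (metis ratfun_value_mult subring_of_field_mult subring_V)
    ultimately show ?thesis
      by (simp add: subring_of_field_def)
  qed
  moreover have "\<phi> \<in> W a d \<or> inverse \<phi> \<in> W a d" if "\<phi> \<noteq> 0" for \<phi>
  proof -
    obtain p q where pq: "\<phi> = Fract p q" "p \<noteq> 0" "q \<noteq> 0"
      by (rule fract_poly_nonzero_cases[OF \<open>\<phi> \<noteq> 0\<close>])
    obtain e i where e: "e \<noteq> 0"
      "\<forall>\<^sub>F n in sequentially. v (poly p (a + d * x n)) = v (e * x n ^ i)"
      using poly_dominating_term[OF pcompose_affine_nonzero[OF pq(2) assms], of a]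
      by (auto simp: poly_pcompose_affine)
    obtain f j where f: "f \<noteq> 0"
      "\<forall>\<^sub>F n in sequentially. v (poly q (a + d * x n)) = v (f * x n ^ j)"
      using poly_dominating_term[OF pcompose_affine_nonzero[OF pq(3) assms], of a]
      by (auto simp: poly_pcompose_affine)
    \<comment> \<open>Kept general in numerator and denominator, to serve both
      \<open>Fract p q\<close> and its inverse \<open>Fract q p\<close>.\<close>
    have quot: "\<exists>y\<in>V. ratfun_value (Fract p' q') t y"
      if "v (poly p' t) = v (e' * x n ^ i')" "v (poly q' t) = v (f' * x n ^ j')"
        "v (f' * x n ^ j') \<le> v (e' * x n ^ i')" "e' \<noteq> 0" "f' \<noteq> 0"
      for p' q' t e' f' i' j' n
    proof -
      have "poly p' t \<noteq> 0" "poly q' t \<noteq> 0"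
        using that by (auto simp: v_zero v_monomial)
      moreover from this have "w (poly q' t) \<le> w (poly p' t)"
        using that(1-3) v_eq_w by (metis ereal_less_eq(3))
      ultimately have "poly p' t / poly q' t \<in> V" "poly q' t \<noteq> 0"
        by (simp_all add: mem_V v_eq_w w_divide zero_ereal_def)
      then show ?thesis
        using ratfun_value_Fract by blast
    qed
    from eventually_v_monomial_cmp[OF e(1) f(1), of i j] show ?thesis
    proof
      assume "\<forall>\<^sub>F n in sequentially. v (e * x n ^ i) \<le> v (f * x n ^ j)"
      with e(2) f(2)
      have "\<forall>\<^sub>F n in sequentially. \<exists>y\<in>V. ratfun_value (Fract q p) (a + d * x n) y"
        by eventually_elim (use quot e(1) f(1) in blast)
      then show ?thesis
        using pq by (simp add: V_seq_def cofinite_eq_sequentially)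
    next
      assume "\<forall>\<^sub>F n in sequentially. v (f * x n ^ j) \<le> v (e * x n ^ i)"
      with e(2) f(2)
      have "\<forall>\<^sub>F n in sequentially. \<exists>y\<in>V. ratfun_value (Fract p q) (a + d * x n) y"
        by eventually_elim (use quot e(1) f(1) in blast)
      then show ?thesis
        using pq by (simp add: V_seq_def cofinite_eq_sequentially)
    qed
  qed
  ultimately show ?thesis
    by (simp add: valuation_domain_def)
qed

lemma W_in_Zar:
  assumes "d \<noteq> 0"
  shows "W a d \<in> Zar V"
proof -
  have "Fract [:c:] 1 \<in> W a d" if "c \<in> V" for c
    using ratfun_value_poly[of "[:c:]"] that by (auto simp: V_seq_def intro!: MOST_I bexI[of _ c])
  then show ?thesis
    using W_valuation_domain[OF assms] by (auto simp: Zar_def)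
qed

text \<open>Of the two terms, \<open>d * x n\<close> has the strictly smaller value and so
  determines that of the difference.\<close>

lemma v_step: "d \<noteq> 0 \<Longrightarrow> v ((a + d * x (Suc n)) - (a + d * x n)) = ereal (w d + w (x n))"
proof -
  assume d: "d \<noteq> 0"
  have "v (d * x n) < v (d * x (Suc n))"
    using w_x_mono d x_nonzero by (simp add: v_eq_w w_mult strict_mono_Suc_iff)
  then have "v (d * x (Suc n) + - (d * x n)) = v (d * x n)"
    using v_add_eq(2)[of "- (d * x n)"] by (simp add: v_minus)
  then show ?thesis
    using d x_nonzero by (simp add: v_eq_w w_mult)
qed

lemma W_in_V_breadth:
  assumes "d \<noteq> 0"
  shows "W a d \<in> V_breadth v V (v d)"
proof -
  have "pseudo_convergent v (\<lambda>n. a + d * x n)"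
    unfolding pseudo_convergent_def
    using v_step[OF assms, of a] w_x_mono by (simp add: strict_mono_Suc_iff)
  moreover have "breadth v (\<lambda>n. a + d * x n) = v d"
  proof -
    have "(\<lambda>n. ereal (w d + w (x n))) \<longlonglongrightarrow> ereal (w d)"
      using tendsto_add[OF tendsto_const w_x_lim, of "w d"] by simp
    from limI[OF this] show ?thesis
      unfolding breadth_def using v_step[OF assms, of a] by (simp add: v_eq_w assms)
  qed
  ultimately show ?thesis
    unfolding V_breadth_def by blast
qed

text \<open>With \<open>X\<close> replaced by \<open>c X\<close>, membership in \<open>W 0 c\<close>
  forces the least coefficient value of the denominator to be at most that of the numerator.
  Division by a denominator coefficient of least value makes both polynomials integral and keeps the
  reduction of the denominator nonzero.\<close>

lemma W_scaled_representation:
  assumes "c \<noteq> 0" "\<psi> \<in> W 0 c"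
  obtains p q where "\<psi> = Fract p q" "\<And>k. coeff (p \<circ>\<^sub>p [:0, c:]) k \<in> V"
    "\<And>k. coeff (q \<circ>\<^sub>p [:0, c:]) k \<in> V" "\<exists>k. coeff (q \<circ>\<^sub>p [:0, c:]) k \<notin> max_ideal V"
proof (cases "\<psi> = 0")
  case True
  show ?thesis
  proof
    show "\<psi> = Fract 0 1"
      using True by (simp add: Zero_fract_def)
    show "\<exists>k. coeff (1 \<circ>\<^sub>p [:0, c:]) k \<notin> max_ideal V"
      using one_notin_max_ideal by (intro exI[of _ 0]) simp
    show "coeff (1 \<circ>\<^sub>p [:0, c:]) k \<in> V" for k
      using subring_V subring_of_field_zero[OF subring_V]
      by (simp add: subring_of_field_def coeff_pCons one_pCons split: nat.split)
  qed (auto simp: subring_of_field_zero subring_V)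
next
  case False
  obtain p q where pq: "\<psi> = Fract p q" "p \<noteq> 0" "q \<noteq> 0"
    by (rule fract_poly_nonzero_cases[OF False])
  obtain e i where e: "e \<noteq> 0" "\<And>k. v e \<le> v (coeff (p \<circ>\<^sub>p [:0, c:]) k)"
    "\<forall>\<^sub>F n in sequentially. v (poly p (0 + c * x n)) = v (e * x n ^ i)"
    using poly_dominating_term[OF pcompose_affine_nonzero[OF pq(2) assms(1)], of 0]
    by (auto simp: poly_pcompose_affine)
  obtain f j where f: "f \<noteq> 0" "\<And>k. v f \<le> v (coeff (q \<circ>\<^sub>p [:0, c:]) k)"
    "f \<in> range (coeff (q \<circ>\<^sub>p [:0, c:]))"
    "\<forall>\<^sub>F n in sequentially. v (poly q (0 + c * x n)) = v (f * x n ^ j)"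
    using poly_dominating_term[OF pcompose_affine_nonzero[OF pq(3) assms(1)], of 0]
    by (auto simp: poly_pcompose_affine)
  \<comment> \<open>Otherwise the numerator would eventually have the smaller value, and the values
    of \<open>\<psi>\<close> would leave \<open>V\<close>.\<close>
  have "w f \<le> w e"
  proof (rule ccontr)
    assume "\<not> ?thesis"
    then have "\<forall>\<^sub>F n in sequentially. v (e * x n ^ i) < v (f * x n ^ j)"
      using e f by (intro eventually_v_monomial_less) auto
    moreover have "\<forall>\<^sub>F n in sequentially. \<exists>y\<in>V. ratfun_value \<psi> (0 + c * x n) y"
      using assms(2) by (simp add: V_seq_def cofinite_eq_sequentially)
    ultimately have "\<forall>\<^sub>F n in sequentially. False"
      using e(3) f(4)
    proof eventually_elim
      case (elim n)
      let ?t = "0 + c * x n"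
      have ne: "poly p ?t \<noteq> 0" "poly q ?t \<noteq> 0"
        using elim e(1) f(1) by (auto simp: v_zero v_monomial)
      then have "poly p ?t / poly q ?t \<in> V"
        using elim(2) ratfun_value_unique ratfun_value_Fract pq(1) by metis
      then have "w (poly q ?t) \<le> w (poly p ?t)"
        using ne by (simp add: mem_V v_eq_w w_divide zero_ereal_def)
      then show False
        using elim(1,3,4) ne v_eq_w by (metis ereal_less_eq(3) leD)
    qed
    then show False by simp
  qed
  then have "v f \<le> v e"
    using e f by (simp add: v_eq_w)
  have scale: "inverse f * y \<in> V" if "v f \<le> v y" for y
    using that f(1)
    by (cases "y = 0") (auto simp: mem_V v_zero v_eq_w w_mult w_inverse zero_ereal_def)
  show ?thesis
  proof
    show "\<psi> = Fract (smult (inverse f) p) (smult (inverse f) q)"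
      using pq f(1) by (simp add: eq_fract)
    show "coeff (smult (inverse f) p \<circ>\<^sub>p [:0, c:]) k \<in> V" for k
      using e(2)[of k] \<open>v f \<le> v e\<close> scale by (simp add: pcompose_smult)
    show "coeff (smult (inverse f) q \<circ>\<^sub>p [:0, c:]) k \<in> V" for k
      using f(2)[of k] scale by (simp add: pcompose_smult)
    \<comment> \<open>This coefficient becomes 1 after scaling.\<close>
    obtain k where "coeff (q \<circ>\<^sub>p [:0, c:]) k = f"
      using f(3) by auto
    then show "\<exists>k. coeff (smult (inverse f) q \<circ>\<^sub>p [:0, c:]) k \<notin> max_ideal V"
      using f(1) one_notin_max_ideal by (intro exI[of _ k]) (simp add: pcompose_smult)
  qed
qed

text \<open>The point \<open>c * u + d * x n\<close> equals \<open>c * (u + m)\<close> with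
  \<open>m\<close> eventually in the maximal ideal. If \<open>u\<close> is not congruent to a root
  of the reduced denominator, the denominator is a unit there; \<open>A\<close> represents these
  finitely many roots.\<close>

lemma W_shift_mem:
  assumes "c \<noteq> 0" "d \<noteq> 0" "w c < w d" "\<psi> \<in> W 0 c"
  shows "\<exists>A. finite A \<and>
    (\<forall>u\<in>V. (\<forall>a\<in>A. u - a \<notin> max_ideal V) \<longrightarrow> \<psi> \<in> W (c * u) d)"
proof -
  obtain p q where pq: "\<psi> = Fract p q" "\<And>k. coeff (p \<circ>\<^sub>p [:0, c:]) k \<in> V"
    "\<And>k. coeff (q \<circ>\<^sub>p [:0, c:]) k \<in> V" "\<exists>k. coeff (q \<circ>\<^sub>p [:0, c:]) k \<notin> max_ideal V"
    using W_scaled_representation[OF assms(1,4)] by metis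
  obtain A where A: "finite A"
    "\<forall>u\<in>V. poly (q \<circ>\<^sub>p [:0, c:]) u \<in> max_ideal V \<longrightarrow> (\<exists>a\<in>A. u - a \<in> max_ideal V)"
    using roots_mod_max_ideal[OF pq(3)] pq(4) by blast
  have "\<psi> \<in> W (c * u) d" if u: "u \<in> V" "\<forall>a\<in>A. u - a \<notin> max_ideal V" for u
  proof -
    \<comment> \<open>The bound is negative, so it is eventually exceeded; this says that
      \<open>d * x n / c\<close> has positive value.\<close>
    have "\<forall>\<^sub>F n in sequentially. w c - w d < w (x n)"
      using assms(3) by (intro order_tendstoD(1)[OF w_x_lim]) simp
    then have "\<forall>\<^sub>F n in sequentially. \<exists>y\<in>V. ratfun_value \<psi> (c * u + d * x n) y"
    proof eventually_elim
      case (elim n)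
      define m where "m = d * x n / c"
      have m: "m \<in> max_ideal V"
        using elim assms x_nonzero by (simp add: m_def mem_max_ideal v_eq_w w_mult w_divide)
      have t: "c * u + d * x n = 0 + c * (u + m)"
        using assms(1) by (simp add: m_def field_simps)
      have um: "u + m \<in> V"
        by (intro subring_of_field_add subring_V u max_ideal_subset m)
      have "poly (q \<circ>\<^sub>p [:0, c:]) (u + m) \<notin> max_ideal V"
      proof
        assume "poly (q \<circ>\<^sub>p [:0, c:]) (u + m) \<in> max_ideal V"
        then obtain a where "a \<in> A" "u + m - a \<in> max_ideal V"
          using A um by blast
        moreover from this have "(u + m - a) - m \<in> max_ideal V"
          using max_ideal_diff m by blast
        ultimately show False
          using u by (auto simp: algebra_simps)
      qed
      moreover have "poly (q \<circ>\<^sub>p [:0, c:]) (u + m) \<in> V" "poly (p \<circ>\<^sub>p [:0, c:]) (u + m) \<in> V"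
        using poly_in_V pq um by auto
      ultimately have *: "poly q (c * u + d * x n) \<notin> max_ideal V"
        "poly q (c * u + d * x n) \<in> V" "poly p (c * u + d * x n) \<in> V"
        unfolding poly_pcompose_affine t by auto
      then have "poly q (c * u + d * x n) \<noteq> 0" "inverse (poly q (c * u + d * x n)) \<in> V"
        by (auto simp: max_ideal_def)
      then have "poly p (c * u + d * x n) / poly q (c * u + d * x n) \<in> V"
        using * subring_of_field_mult[OF subring_V] by (simp add: divide_inverse)
      then show ?case
        using ratfun_value_Fract pq(1) \<open>poly q (c * u + d * x n) \<noteq> 0\<close> by blast
    qed
    then show ?thesis
      by (simp add: V_seq_def cofinite_eq_sequentially)
  qed
  then show ?thesis
    using A(1) by blast
qed

text \<open>Every Zariski neighbourhood of \<open>W 0 c\<close> contains some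
  \<open>W (c * u) d\<close> with \<open>u\<close> in \<open>V\<close>, whereas \<open>X / c\<close>
  separates these points from \<open>W 0 c\<close>.\<close>

lemma infinite_residue_field_imp_not_zar_eq_cons:
  assumes inf: "infinite (residue_field V)"
    and cd: "c \<noteq> 0" "d \<noteq> 0" "w c < w d"
    and S: "W 0 c \<in> S" "\<And>a. W a d \<in> S"
  shows "\<not> zar_eq_cons_on V S"
proof
  assume eq: "zar_eq_cons_on V S"
  define \<phi> where "\<phi> = Fract [:0, inverse c:] 1"
  have "ratfun_value \<phi> t (t / c)" for t
    using ratfun_value_poly[of "[:0, inverse c:]" t] by (simp add: \<phi>_def divide_inverse)
  then have val: "ratfun_value \<phi> t y \<longleftrightarrow> y = t / c" for t y
    using ratfun_value_unique by blast
  have phi_iff: "\<phi> \<in> W a b \<longleftrightarrow> (\<forall>\<^sub>F n in sequentially. (a + b * x n) / c \<in> V)" for a b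
    by (simp add: V_seq_def cofinite_eq_sequentially val)
  have "(0 + c * x n) / c \<notin> V" for n
    using w_x_neg[of n] x_nonzero cd by (simp add: mem_V v_eq_w zero_ereal_def not_le)
  then have notin: "\<phi> \<notin> W 0 c"
    unfolding phi_iff by simp
  have inW: "\<phi> \<in> W (c * u) d" if "u \<in> V" for u
  proof -
    have "\<forall>\<^sub>F n in sequentially. w c - w d < w (x n)"
      using cd by (intro order_tendstoD(1)[OF w_x_lim]) simp
    then have "\<forall>\<^sub>F n in sequentially. (c * u + d * x n) / c \<in> V"
    proof eventually_elim
      case (elim n)
      have "d * x n / c \<in> V"
        using elim cd x_nonzero by (simp add: mem_V v_eq_w w_mult w_divide zero_ereal_def)
      then have "u + d * x n / c \<in> V"
        using subring_of_field_add[OF subring_V that] by blast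
      then show ?case
        using cd by (simp add: add_divide_distrib)
    qed
    then show ?thesis
      by (simp add: phi_iff)
  qed
  have "openin (subtopology (constructible_topology V) S) ((Zar V - Zar_B V \<phi>) \<inter> S)"
    using openin_constructible_complement by (rule openin_subtopology_Int)
  then have "openin (subtopology (zariski_topology V) S) ((Zar V - Zar_B V \<phi>) \<inter> S)"
    using eq by (simp add: zar_eq_cons_on_def)
  then obtain T where T: "openin (zariski_topology V) T" "(Zar V - Zar_B V \<phi>) \<inter> S = T \<inter> S"
    unfolding openin_subtopology by blast
  have T_iff: "Z \<in> T \<longleftrightarrow> \<phi> \<notin> Z" if "Z \<in> Zar V" "Z \<in> S" for Z
    using T(2) that unfolding Zar_B_def by blast
  have "W 0 c \<in> T"
    using T_iff[OF W_in_Zar[OF cd(1)] S(1)] notin by blast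
  then obtain P where P: "finite P" "P \<subseteq> W 0 c" "\<forall>Z\<in>Zar V. P \<subseteq> Z \<longrightarrow> Z \<in> T"
    by (rule openin_zariski_finite_nbhd[OF T(1)])
  have "\<forall>\<psi>\<in>P. \<exists>A. finite A \<and>
      (\<forall>u\<in>V. (\<forall>a\<in>A. u - a \<notin> max_ideal V) \<longrightarrow> \<psi> \<in> W (c * u) d)"
    using W_shift_mem[OF cd subsetD[OF P(2)]] by (intro ballI)
  then obtain A where A: "\<forall>\<psi>\<in>P. finite (A \<psi>) \<and>
      (\<forall>u\<in>V. (\<forall>a\<in>A \<psi>. u - a \<notin> max_ideal V) \<longrightarrow> \<psi> \<in> W (c * u) d)"
    by metis
  then have "finite (\<Union>\<psi>\<in>P. A \<psi>)"
    using P(1) by blast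
  \<comment> \<open>The infinite residue field allows one \<open>u\<close> that avoids the
    exceptional classes of all members of \<open>P\<close> at once.\<close>
  then obtain u where u: "u \<in> V" "\<forall>a\<in>(\<Union>\<psi>\<in>P. A \<psi>). u - a \<notin> max_ideal V"
    by (rule infinite_residue_field_avoid[OF inf])
  have "P \<subseteq> W (c * u) d"
  proof
    fix \<psi> assume "\<psi> \<in> P"
    then show "\<psi> \<in> W (c * u) d"
      using A u(2) \<open>u \<in> V\<close> by simp
  qed
  then have "W (c * u) d \<in> T"
    by (rule P(3)[rule_format, OF W_in_Zar[OF cd(2)]])
  then show False
    using T_iff[OF W_in_Zar[OF cd(2)] S(2)] inW[OF u(1)] by blast
qed

end

text \<open>Powers of \<open>inverse g\<close> have arbitrarily negative values, so two different
  breadths below \<open>\<delta>\<close> can be realised. As \<open>S\<close> is any larger set, one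
  statement covers all three families of the theorem.\<close>

lemma (in real_valued_field) not_zar_eq_cons_on_V_breadth:
  assumes "\<not> discrete_valuation v" "krull_dim V = 1" "infinite (residue_field V)" "\<delta> \<noteq> -\<infinity>"
    and S: "(\<Union>\<delta>'\<in>{-\<infinity><..<\<delta>}. V_breadth v V \<delta>') \<subseteq> S"
  shows "\<not> zar_eq_cons_on V S"
proof -
  obtain g where g: "g \<noteq> 0" "w g > 0"
    using krull_dim_imp_nontrivial[OF assms(2)] by blast
  obtain x where x: "\<And>n. x n \<noteq> 0" "\<And>n. w (x n) < 0" "strict_mono (\<lambda>n. w (x n))"
    "(\<lambda>n. w (x n)) \<longlonglongrightarrow> 0"
    using exists_seq_values_to_zero[OF assms(1) g] by metis
  interpret real_valued_field_seq v V x
    by unfold_locales (use x in auto)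
  \<comment> \<open>A real bound also makes sense of "sufficiently negative" when
    \<open>\<delta> = \<infinity>\<close>.\<close>
  obtain r :: real where r: "ereal r < \<delta>"
    using ereal_dense2[of "-\<infinity>" \<delta>] assms(4) by auto
  obtain N :: nat where N: "- r < N * w g"
    using reals_Archimedean3[OF g(2)] by blast
  \<comment> \<open>This gives \<open>w d = - N * w g < r\<close>, and dividing by \<open>g\<close>
    lowers the value once more.\<close>
  define d where "d = inverse (g ^ N)"
  define c where "c = d / g"
  have cd: "c \<noteq> 0" "d \<noteq> 0" "w c < w d" and "w d < r"
    using g N by (auto simp: c_def d_def w_divide w_inverse w_power)
  have mem: "W a b \<in> S" if "b \<noteq> 0" "w b < r" for a b
  proof -
    have "v b \<in> {-\<infinity><..<\<delta>}"
      using that r by (auto simp: v_eq_w intro: less_trans[of _ "ereal r"])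
    then show ?thesis
      using W_in_V_breadth[OF that(1), of a] S by blast
  qed
  show ?thesis
    by (rule infinite_residue_field_imp_not_zar_eq_cons[OF assms(3) cd])
      (rule mem; use cd \<open>w d < r\<close> in simp)+
qed

theorem proposition6p11:
  fixes V :: "'a::field set" and v :: "'a \<Rightarrow> ereal"
  assumes "valuation_domain V"
    and "krull_dim V = 1"
    and "real_valuation_of v V"
    and "\<not> discrete_valuation v"
  shows
    "(finite (residue_field V) \<longleftrightarrow> zar_eq_cons_on V (V_all v V)) \<and>
     (finite (residue_field V) \<longleftrightarrow>
        (\<exists>\<delta>::ereal. \<delta> \<noteq> -\<infinity> \<and> zar_eq_cons_on V (\<Union>\<delta>'\<in>{-\<infinity><..\<delta>}. V_breadth v V \<delta>'))) \<and>
     (finite (residue_field V) \<longleftrightarrow>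
        (\<exists>\<delta>::ereal. \<delta> \<noteq> -\<infinity> \<and> zar_eq_cons_on V (\<Union>\<delta>'\<in>{-\<infinity><..<\<delta>}. V_breadth v V \<delta>')))"
proof -
  interpret real_valued_field v V
    by unfold_locales (rule assms(3))
  have fin: "zar_eq_cons_on V S" if "finite (residue_field V)" "S \<subseteq> range (V_seq V)" for S
    using finite_residue_field_imp_zar_eq_cons[OF that(1)] that(2) by (rule zar_eq_cons_on_subset)
  have inf: "\<delta> \<noteq> -\<infinity> \<Longrightarrow> (\<Union>\<delta>'\<in>{-\<infinity><..<\<delta>}. V_breadth v V \<delta>') \<subseteq> S \<Longrightarrow>
      zar_eq_cons_on V S \<Longrightarrow> finite (residue_field V)" for \<delta> S
    using not_zar_eq_cons_on_V_breadth[OF assms(4,2)] by blast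
  have all: "V_all v V \<subseteq> range (V_seq V)"
    by (auto simp: V_all_def)
  have breadth: "(\<Union>\<delta>\<in>D. V_breadth v V \<delta>) \<subseteq> V_all v V" for D
    by (auto simp: V_breadth_def V_all_def)
  show ?thesis
  proof (intro conjI iffI)
    assume "finite (residue_field V)"
    then show "zar_eq_cons_on V (V_all v V)"
      by (rule fin[OF _ all])
  next
    assume "zar_eq_cons_on V (V_all v V)"
    \<comment> \<open>The points of finite breadth already carry the obstruction, hence the choice
      \<open>\<delta> = \<infinity>\<close>.\<close>
    from inf[OF _ breadth this, of \<infinity>] show "finite (residue_field V)"
      by simp
  next
    assume "finite (residue_field V)"
    then have "zar_eq_cons_on V (\<Union>\<delta>'\<in>{-\<infinity><..\<infinity>}. V_breadth v V \<delta>')"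
      by (rule fin[OF _ order_trans[OF breadth all]])
    then show "\<exists>\<delta>::ereal. \<delta> \<noteq> -\<infinity> \<and>
        zar_eq_cons_on V (\<Union>\<delta>'\<in>{-\<infinity><..\<delta>}. V_breadth v V \<delta>')"
      by (intro exI[of _ \<infinity>] conjI) simp_all
  next
    assume "\<exists>\<delta>::ereal. \<delta> \<noteq> -\<infinity> \<and>
        zar_eq_cons_on V (\<Union>\<delta>'\<in>{-\<infinity><..\<delta>}. V_breadth v V \<delta>')"
    then obtain \<delta> :: ereal where "\<delta> \<noteq> -\<infinity>"
      and eq: "zar_eq_cons_on V (\<Union>\<delta>'\<in>{-\<infinity><..\<delta>}. V_breadth v V \<delta>')"
      by (elim exE conjE)
    \<comment> \<open>The obstruction already sits in the part with strictly smaller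
      breadth.\<close>
    have "(\<Union>\<delta>'\<in>{-\<infinity><..<\<delta>}. V_breadth v V \<delta>') \<subseteq>
        (\<Union>\<delta>'\<in>{-\<infinity><..\<delta>}. V_breadth v V \<delta>')"
      by (intro UN_mono) auto
    from inf[OF \<open>\<delta> \<noteq> -\<infinity>\<close> this eq] show "finite (residue_field V)" .
  next
    assume "finite (residue_field V)"
    then have "zar_eq_cons_on V (\<Union>\<delta>'\<in>{-\<infinity><..<\<infinity>}. V_breadth v V \<delta>')"
      by (rule fin[OF _ order_trans[OF breadth all]])
    then show "\<exists>\<delta>::ereal. \<delta> \<noteq> -\<infinity> \<and>
        zar_eq_cons_on V (\<Union>\<delta>'\<in>{-\<infinity><..<\<delta>}. V_breadth v V \<delta>')"
      by (intro exI[of _ \<infinity>] conjI) simp_all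
  next
    assume "\<exists>\<delta>::ereal. \<delta> \<noteq> -\<infinity> \<and>
        zar_eq_cons_on V (\<Union>\<delta>'\<in>{-\<infinity><..<\<delta>}. V_breadth v V \<delta>')"
    then show "finite (residue_field V)"
      by (elim exE conjE) (rule inf[OF _ subset_refl])
  qed
qed

end
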